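(* Let $r>1$, $n\ge1$, and let $\delta_{r,1},\dots,\delta_{r,n}$ be i.i.d.\ random variables with $\mathrm{Prob}(\delta_{r,i}=1)=1/r$ and $\mathrm{Prob}(\delta_{r,i}=-1)=1-1/r$. Then for all $\sigma,\tau\in\mathfrak{S}_n$ and $\beta\in\operatorname{Comp}(n)$, $$K^{\vartheta_r}_n(\sigma,\tau)=\mathrm{Prob}\big(\operatorname{st}((\delta_{r,1}\sigma_1,\dots,\delta_{r,n}\sigma_n))=\tau\big),\qquad \overline{K}^{\vartheta_r}_n(D(\sigma),\beta)=\mathrm{Prob}\big(D((\delta_{r,1}\sigma_1,\dots,\delta_{r,n}\sigma_n))=\beta\big).$$
   Context: Work over $\mathbb{R}$. Compositions, $\operatorname{Comp}(n)$, $(n)$; for $S\subseteq[n-1]$ with elements $s_1<\dots<s_j$, $\operatorname{co}(S)=(s_1,s_2-s_1,\dots,n-s_j)$. $M_\alpha=\sum_{i_1<\dots<i_k}x_{i_1}^{a_1}\cdots x_{i_k}^{a_k}$; $\mathcal{Q}=\bigoplus\mathcal{Q}_n$ quasisymmetric functions; $F_\alpha=\sum_\beta M_\beta$ over compositions $\beta$ of $n$ refining $\alpha$. For a sequence $w=(w_1,\dots,w_n)$ of distinct reals, $D(w)=\operatorname{co}(\{i:w_i>w_{i+1}\})$ and $\operatorname{st}(w)$ is the unique permutation $\tau\in\mathfrak{S}_n$ with $w_i<w_j\iff\tau_i<\tau_j$. Permutations are in one-line notation; product is composition. $\vartheta_r$: for an $ab$-word $u=u_1\cdots u_{n-1}$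 let $S_u=\{i:u_i=b\}$ and $\gamma(u)=F_{\operatorname{co}(S_u)}\in\mathcal{Q}_n$ (a linear isomorphism from $ab$-polynomials onto $\bigoplus_{n\ge1}\mathcal{Q}_n$). $\omega_r$ acts on a word by factoring it into blocks that are occurrences of $ab$ or single remaining letters, sending $ab\mapsto r(ab-(r-1)ba)$, $a\mapsto a+(r-1)b$, $b\mapsto b+(r-1)a$, and multiplying in order. $\vartheta_r(F)=\gamma(r\,\omega_r(\gamma^{-1}F))$ on positive degrees, $\vartheta_r(1)=1$; it is a Hopf endomorphism of $\mathcal{Q}$. For $\Phi=\vartheta_r$: define $c_{\alpha,\beta}$ by $\Phi(F_\alpha)=\sum_\beta c_{\alpha,\beta}F_\beta$ ($\alpha,\beta\in\operatorname{Comp}(n)$), $\lambda$ by $\Phi(M_{(1)})=\lambda M_{(1)}$, $\mathrm{Prob}_\Phi(\pi)=c_{D(\pi),(n)}/\sum_{\sigma}c_{D(\sigma),(n)}$, $K^{\Phi}_n(\pi,\sigma\pi)=\mathrm{Prob}_\Phi(\sigma^{-1})$, and $\overline{K}^\Phi_n(\alpha,\beta)=c_{\alpha,\beta}/\lambda^n$.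
   Formalization: The sign in the definition of ω_r is corrected: ab ↦ r(ab+(r−1)ba) instead of r(ab−(r−1)ba); with the minus sign the second identity fails, e.g. σ=132, β=(1,2) would give the negative value −(r−1)/r. *)

theory Defs
  imports
    "HOL-Probability.Probability"
    "HOL-Library.Poly_Mapping"
    "HOL-Combinatorics.Permutations"
begin

section \<open>Compositions\<close>

definition Comp :: "nat \<Rightarrow> nat list set" where
  "Comp n = {\<alpha>. (\<forall>a\<in>set \<alpha>. 0 < a) \<and> sum_list \<alpha> = n}"

(* (s_1, s_2 - s_1, ..., n - s_j), for n >= 1 and S a subset of {1..n-1} *)
definition co :: "nat \<Rightarrow> nat set \<Rightarrow> nat list" where
  "co n S = (let s = sorted_list_of_set S in map2 (\<lambda>x y. y - x) (0 # s) (s @ [n]))"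

definition refines :: "nat list \<Rightarrow> nat list \<Rightarrow> bool" where
  "refines \<beta> \<alpha> \<longleftrightarrow> (\<exists>bs. concat bs = \<beta> \<and> map sum_list bs = \<alpha>)"


section \<open>Quasisymmetric functions\<close>

text \<open>
  Formal power series in the variables x_0, x_1, ... are coefficient functions on monomials, a
  monomial being a finitely supported exponent vector. Linear combinations are written pointwise.
\<close>

type_synonym monomial = "nat \<Rightarrow>\<^sub>0 nat"
type_synonym series = "monomial \<Rightarrow> real"

(* The coefficient at m counts the terms x_{i_1}^{a_1} ... x_{i_k}^{a_k} with
   i_1 < ... < i_k that equal m. *)
definition Mqs :: "nat list \<Rightarrow> series" where
  "Mqs \<alpha> = (\<lambda>m. real (card {is. length is = length \<alpha> \<and> sorted_wrt (<) is \<and>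
                               sum_list (map2 Poly_Mapping.single is \<alpha>) = m}))"

definition Fqs :: "nat list \<Rightarrow> series" where
  "Fqs \<alpha> = (\<lambda>m. \<Sum>\<beta> | \<beta> \<in> Comp (sum_list \<alpha>) \<and> refines \<beta> \<alpha>. Mqs \<beta> m)"


section \<open>Polynomials in the noncommuting variables a and b\<close>

datatype letter = A | B

(* Words under concatenation, written additively so that the library's convolution product makes
   the finitely supported functions on words the free associative algebra. *)
datatype abword = Word (letters: "letter list")

instantiation abword :: monoid_add
begin
definition "0 = Word []"
definition "u + v = Word (letters u @ letters v)"
instance by standard (auto simp: zero_abword_def plus_abword_def)
end

type_synonym abpoly = "abword \<Rightarrow>\<^sub>0 real"

abbreviation const :: "real \<Rightarrow> abpoly" where
  "const c \<equiv> Poly_Mapping.single 0 c"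

abbreviation word :: "letter list \<Rightarrow> abpoly" where
  "word u \<equiv> Poly_Mapping.single (Word u) 1"

definition bset :: "letter list \<Rightarrow> nat set" where
  "bset u = {i \<in> {1..length u}. u ! (i - 1) = B}"

definition gamma :: "abpoly \<Rightarrow> series" where
  "gamma p = (\<lambda>m. \<Sum>u\<in>Poly_Mapping.keys p.
     Poly_Mapping.lookup p u * Fqs (co (length (letters u) + 1) (bset (letters u))) m)"


section \<open>The map theta\<close>

(* Occurrences of ab never overlap, so reading from the left finds all blocks.
   The coefficient of ba in the image of ab is +r(r-1). With -r(r-1) in its place theta would not
   be multiplicative: for r > 1 the equation theta(M_1^3) = theta(M_1)^3 would fail. *)
fun omega_word :: "real \<Rightarrow> letter list \<Rightarrow> abpoly" where
  "omega_word r [] = 1"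
| "omega_word r (A # B # u) =
     const r * (word [A, B] + const (r - 1) * word [B, A]) * omega_word r u"
| "omega_word r (A # u) = (word [A] + const (r - 1) * word [B]) * omega_word r u"
| "omega_word r (B # u) = (word [B] + const (r - 1) * word [A]) * omega_word r u"

definition omega :: "real \<Rightarrow> abpoly \<Rightarrow> abpoly" where
  "omega r p = (\<Sum>u\<in>Poly_Mapping.keys p.
     const (Poly_Mapping.lookup p u) * omega_word r (letters u))"

(* Linear extension of theta(1) = 1 and theta(F) = gamma (r omega (gamma^{-1} F)) in positive
   degrees; f 0 is the constant term of f. Only the values at quasisymmetric f are meaningful. *)
definition theta :: "real \<Rightarrow> series \<Rightarrow> series" where
  "theta r f = (\<lambda>m. (if m = 0 then f 0 else 0) +
     gamma (const r * omega r (the_inv gamma (\<lambda>m. if m = 0 then 0 else f m))) m)"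


section \<open>Descents and standardization\<close>

text \<open>
  A sequence of length n is the restriction to {1..n} of a function on the naturals. The symmetric
  group consists of the functions permuting {1..n} (identity elsewhere), so the product is function
  composition.
\<close>

definition Dcomp :: "nat \<Rightarrow> (nat \<Rightarrow> real) \<Rightarrow> nat list" where
  "Dcomp n w = co n {i. 1 \<le> i \<and> i < n \<and> w i > w (i + 1)}"

definition Dperm :: "nat \<Rightarrow> (nat \<Rightarrow> nat) \<Rightarrow> nat list" where
  "Dperm n \<pi> = Dcomp n (\<lambda>i. real (\<pi> i))"

definition st :: "nat \<Rightarrow> (nat \<Rightarrow> real) \<Rightarrow> (nat \<Rightarrow> nat)" where
  "st n w = (THE \<tau>. \<tau> permutes {1..n} \<and>
     (\<forall>i\<in>{1..n}. \<forall>j\<in>{1..n}. w i < w j \<longleftrightarrow> \<tau> i < \<tau> j))"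


section \<open>The Markov chains attached to an endomorphism\<close>

definition fcoeff :: "(series \<Rightarrow> series) \<Rightarrow> nat list \<Rightarrow> nat list \<Rightarrow> real" where
  "fcoeff \<Phi> \<alpha> = (THE c. (\<forall>\<beta>. \<beta> \<notin> Comp (sum_list \<alpha>) \<longrightarrow> c \<beta> = 0) \<and>
     \<Phi> (Fqs \<alpha>) = (\<lambda>m. \<Sum>\<beta>\<in>Comp (sum_list \<alpha>). c \<beta> * Fqs \<beta> m))"

definition lam :: "(series \<Rightarrow> series) \<Rightarrow> real" where
  "lam \<Phi> = (THE l. \<Phi> (Mqs [1]) = (\<lambda>m. l * Mqs [1] m))"

definition Prob :: "(series \<Rightarrow> series) \<Rightarrow> nat \<Rightarrow> (nat \<Rightarrow> nat) \<Rightarrow> real" where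
  "Prob \<Phi> n \<pi> =
     fcoeff \<Phi> (Dperm n \<pi>) [n] / (\<Sum>\<sigma> | \<sigma> permutes {1..n}. fcoeff \<Phi> (Dperm n \<sigma>) [n])"

(* For tau = sigma o pi this is Prob (inv sigma), since sigma = tau o inv pi. *)
definition K :: "(series \<Rightarrow> series) \<Rightarrow> nat \<Rightarrow> (nat \<Rightarrow> nat) \<Rightarrow> (nat \<Rightarrow> nat) \<Rightarrow> real" where
  "K \<Phi> n \<pi> \<tau> = Prob \<Phi> n (inv (\<tau> \<circ> inv \<pi>))"

definition Kbar :: "(series \<Rightarrow> series) \<Rightarrow> nat \<Rightarrow> nat list \<Rightarrow> nat list \<Rightarrow> real" where
  "Kbar \<Phi> n \<alpha> \<beta> = fcoeff \<Phi> \<alpha> \<beta> / lam \<Phi> ^ n"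

end

theory Submission
  imports Defs
begin

text \<open>
  Multiplying positive distinct numbers by signs leaves each adjacent comparison as it is or reverses
  it, according to the sign of the larger of the two entries. The two comparisons of a peak, that is
  of a factor ab of the descent word, share their larger entry; otherwise distinct comparisons depend
  on distinct signs. This independence is exactly the product formula defining omega: r omega maps
  the descent word of c to the weighted sum of the descent words of all signed versions of c.
  For the chain on permutations, rearranging the i.i.d. signs by the inverse of tau turns the event
  st = tau into the event of having no descents.
\<close>

section \<open>Independence of the fundamental quasisymmetric functions\<close>

text \<open>A word with n - 1 letters and k factors ab has n - 1 - k blocks, each ruled by one of
  the n signs, so k + 1 signs are free. A sign is positive with weight 1 and negative with weight r
  - 1, so a free sign sums to r: this is the origin of the r at each ab and of the extra r in front
  of omega. An induction on words meets an obstacle at a letter a, whose sign is also the first sign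
  of the remaining word, so the sum over signs does not factor there. If the remaining word does not
  begin with b, that sign is free in it and can be split off. Since \<open>theta\<close> inverts
  \<open>gamma\<close> and \<open>fcoeff\<close> is a definite description, both are evaluated
  through the linear independence of the F.\<close>

lemma Comp_iff: "\<alpha> \<in> Comp n \<longleftrightarrow> (\<forall>a\<in>set \<alpha>. 0 < a) \<and> sum_list \<alpha> = n"
  by (simp add: Comp_def)

lemma finite_Comp: "finite (Comp n)"
proof (rule finite_subset)
  show "Comp n \<subseteq> {xs. set xs \<subseteq> {0..n} \<and> length xs \<le> n}"
  proof
    fix xs assume "xs \<in> Comp n"
    then have "\<forall>a\<in>set xs. 0 < a" and s: "sum_list xs = n" by (auto simp: Comp_iff)
    from this(1) have "length xs \<le> sum_list xs"
      by (induction xs) auto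
    with s show "xs \<in> {xs. set xs \<subseteq> {0..n} \<and> length xs \<le> n}"
      using member_le_sum_list[of _ xs] by auto
  qed
  show "finite {xs. set xs \<subseteq> {0..n} \<and> length xs \<le> n}"
    by (rule finite_lists_length_le) simp
qed

lemma refines_refl: "refines \<alpha> \<alpha>"
  unfolding refines_def
  by (rule exI[of _ "map (\<lambda>a. [a]) \<alpha>"]) (induction \<alpha>, auto)

text \<open>Each part of \<alpha> is the sum of a block of \<beta>, and positivity excludes empty
  blocks. If the numbers of parts agree, every block is a singleton.\<close>

lemma refines_length:
  assumes "refines \<beta> \<alpha>" and "\<forall>a\<in>set \<alpha>. 0 < a"
  shows "length \<alpha> \<le> length \<beta>" and "length \<beta> = length \<alpha> \<Longrightarrow> \<beta> = \<alpha>"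
proof -
  obtain bs where bs: "concat bs = \<beta>" "map sum_list bs = \<alpha>"
    using assms(1) by (auto simp: refines_def)
  have ne: "\<forall>b\<in>set bs. b \<noteq> []"
    using assms(2) bs(2) by force
  have le: "length xs \<le> length (concat xs)" if "\<forall>b\<in>set xs. b \<noteq> []" for xs :: "nat list list"
    using that
  proof (induction xs)
    case (Cons b xs)
    then have "0 < length b" "length xs \<le> length (concat xs)" by auto
    then show ?case by (simp only: list.size concat.simps length_append)
  qed simp
  have "length (concat bs) = length bs \<Longrightarrow> concat bs = map sum_list bs"
    using ne
  proof (induction bs)
    case (Cons b bs)
    have "length bs \<le> length (concat bs)"
      using Cons.prems(2) le by simp
    moreover have "length b \<ge> 1" using Cons.prems(2) by (simp add: Suc_le_eq)
    ultimately have "length b = 1" and "length (concat bs) = length bs"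
      using Cons.prems(1) by auto
    with Cons show ?case by (auto simp: length_Suc_conv)
  qed simp
  moreover have "length bs = length \<alpha>" using bs(2) by auto
  ultimately show "length \<alpha> \<le> length \<beta>" "length \<beta> = length \<alpha> \<Longrightarrow> \<beta> = \<alpha>"
    using le[OF ne] unfolding bs by simp_all
qed

section \<open>Subsets and words encoded as compositions\<close>

text \<open>Generalizes \<open>co\<close> to an arbitrary start p, since an induction on the list
  replaces the start 0 by the first element.\<close>

definition diffs :: "nat \<Rightarrow> nat list \<Rightarrow> nat \<Rightarrow> nat list" where
  "diffs p s n = map2 (\<lambda>x y. y - x) (p # s) (s @ [n])"

lemma diffs_simps [simp]:
  "diffs p [] n = [n - p]" "diffs p (x # s) n = (x - p) # diffs x s n"
  by (simp_all add: diffs_def)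

lemma co_eq_diffs: "co n S = diffs 0 (sorted_list_of_set S) n"
  by (simp add: co_def diffs_def Let_def)

lemma co_empty: "co n {} = [n]"
  by (simp add: co_eq_diffs)

lemma length_diffs: "length (diffs p s n) = Suc (length s)"
  by (simp add: diffs_def)

lemma diffs_composition:
  "sorted_wrt (<) (p # s) \<Longrightarrow> \<forall>x\<in>set (p # s). x < n
    \<Longrightarrow> (\<forall>a\<in>set (diffs p s n). 0 < a) \<and> sum_list (diffs p s n) = n - p"
  by (induction s arbitrary: p) fastforce+

lemma diffs_inject:
  "sorted_wrt (<) (p # s) \<Longrightarrow> sorted_wrt (<) (p # t) \<Longrightarrow> diffs p s n = diffs p t n \<Longrightarrow> s = t"
proof (induction s arbitrary: p t)
  case Nil
  from arg_cong[OF Nil(3), of length] show ?case by (simp only: length_diffs list.size) auto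
next
  case (Cons x s)
  then obtain y t' where t: "t = y # t'"
    using length_diffs[of p t n] length_diffs[of x s n] by (cases t) auto
  \<comment> \<open>Both x and y exceed p, so the truncated subtraction can be cancelled.\<close>
  with Cons.prems have "x = y" by auto
  with Cons t show ?case by auto
qed

lemma co_in_Comp:
  assumes "S \<subseteq> {1..<n}" and "n \<ge> 1"
  shows "co n S \<in> Comp n"
proof -
  have "finite S" using assms(1) finite_subset by blast
  then show ?thesis
    using diffs_composition[of 0 "sorted_list_of_set S" n] assms
    by (simp add: co_eq_diffs Comp_iff subset_eq Suc_le_eq)
qed

lemma co_inject:
  assumes "S \<subseteq> {1..<n}" "T \<subseteq> {1..<n}" "co n S = co n T"
  shows "S = T"
proof -
  have fin: "finite S" "finite T" using assms finite_subset by blast+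
  have "sorted_list_of_set S = sorted_list_of_set T"
    by (rule diffs_inject[of 0 _ _ n]) (use assms fin in \<open>auto simp: co_eq_diffs\<close>)
  then show ?thesis using fin by (metis set_sorted_list_of_set)
qed

definition word_comp :: "letter list \<Rightarrow> nat list" where
  "word_comp u = co (length u + 1) (bset u)"

lemma bset_subset: "bset u \<subseteq> {1..<length u + 1}"
  by (auto simp: bset_def)

lemma word_comp_in_Comp: "word_comp u \<in> Comp (length u + 1)"
  unfolding word_comp_def by (intro co_in_Comp bset_subset) simp

text \<open>The sum of the parts recovers the length, also between different degrees; injectivity of
  \<open>co\<close> then recovers the positions of b.\<close>

lemma word_comp_inject:
  assumes "word_comp u = word_comp v"
  shows "u = v"
proof -
  have len: "length u = length v"
    using assms word_comp_in_Comp[of u] word_comp_in_Comp[of v] by (simp add: Comp_iff)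
  have b: "bset u = bset v"
    using assms len bset_subset[of u] bset_subset[of v]
    unfolding word_comp_def by (metis co_inject)
  show ?thesis
  proof (rule nth_equalityI[OF len])
    fix i assume "i < length u"
    then have "(u ! i = B) = (Suc i \<in> bset u)" "(v ! i = B) = (Suc i \<in> bset v)"
      using len by (auto simp: bset_def)
    then show "u ! i = v ! i" using b by (metis (full_types) letter.exhaust)
  qed
qed

text \<open>The packed monomial x_0^a_1 ... x_(k-1)^a_k occurs in a single monomial quasisymmetric
  function, so its coefficient reads off the coordinates in the M-basis.\<close>

definition place :: "nat list \<Rightarrow> nat list \<Rightarrow> monomial" where
  "place is \<alpha> = sum_list (map2 Poly_Mapping.single is \<alpha>)"

definition packed :: "nat list \<Rightarrow> monomial" where
  "packed \<alpha> = place [0..<length \<alpha>] \<alpha>"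

lemma lookup_place_notin:
  "i \<notin> set is \<Longrightarrow> Poly_Mapping.lookup (place is \<alpha>) i = 0"
  unfolding place_def
proof (induction "is" arbitrary: \<alpha>)
  case (Cons j js)
  then show ?case by (cases \<alpha>) (auto simp: lookup_add lookup_single when_def)
qed simp

lemma lookup_place_nth:
  assumes "distinct is" "length is = length \<alpha>" "k < length is"
  shows "Poly_Mapping.lookup (place is \<alpha>) (is ! k) = \<alpha> ! k"
  using assms
proof (induction "is" arbitrary: \<alpha> k)
  case (Cons j js)
  then obtain a \<alpha>' where \<alpha>: "\<alpha> = a # \<alpha>'" by (cases \<alpha>) auto
  have place: "place (j # js) (a # \<alpha>') = Poly_Mapping.single j a + place js \<alpha>'"
    by (simp add: place_def)
  show ?case
  proof (cases k)
    case 0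
    with Cons.prems show ?thesis
      by (simp add: place \<alpha> lookup_add lookup_place_notin)
  next
    case (Suc k')
    with Cons.prems have "js ! k' \<noteq> j" by auto
    with Suc Cons \<alpha> show ?thesis by (simp add: place lookup_add lookup_single when_def)
  qed
qed simp

lemma keys_place:
  assumes "distinct is" "length is = length \<alpha>" "\<forall>a\<in>set \<alpha>. 0 < a"
  shows "Poly_Mapping.keys (place is \<alpha>) = set is"
proof
  show "Poly_Mapping.keys (place is \<alpha>) \<subseteq> set is"
    by (meson in_keys_iff lookup_place_notin subsetI)
  show "set is \<subseteq> Poly_Mapping.keys (place is \<alpha>)"
  proof
    fix i assume "i \<in> set is"
    then obtain k where k: "k < length is" "i = is ! k" by (auto simp: in_set_conv_nth)
    then have "0 < \<alpha> ! k" using assms(2,3) by auto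
    then show "i \<in> Poly_Mapping.keys (place is \<alpha>)"
      using lookup_place_nth[OF assms(1,2) k(1)] k(2) by (simp add: in_keys_iff)
  qed
qed

text \<open>Positive exponents make the support of the monomial equal to the index set, which
  determines the increasing index list; the exponents are then read off position by
  position.\<close>

lemma place_eq_packed_iff:
  assumes "\<forall>a\<in>set \<alpha>. 0 < a" "\<forall>b\<in>set \<beta>. 0 < b"
    and "sorted_wrt (<) is" "length is = length \<beta>"
  shows "place is \<beta> = packed \<alpha> \<longleftrightarrow> is = [0..<length \<alpha>] \<and> \<beta> = \<alpha>"
proof
  assume eq: "place is \<beta> = packed \<alpha>"
  have dist: "distinct is" using assms(3) by (simp add: strict_sorted_iff)
  have "set is = set [0..<length \<alpha>]"
    using keys_place[OF dist assms(4,2)] keys_place[of "[0..<length \<alpha>]" \<alpha>] assms(1) eq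
    by (simp add: packed_def)
  then have "is": "is = [0..<length \<alpha>]"
    using assms(3) by (intro sorted_distinct_set_unique) (auto simp: strict_sorted_iff)
  then have len: "length \<beta> = length \<alpha>" using assms(4) by simp
  moreover have "\<beta> ! k = \<alpha> ! k" if "k < length \<beta>" for k
    using lookup_place_nth[OF dist assms(4), of k] lookup_place_nth[of "[0..<length \<alpha>]" \<alpha> k]
      that len eq "is" by (simp add: packed_def)
  ultimately show "is = [0..<length \<alpha>] \<and> \<beta> = \<alpha>"
    using "is" by (simp add: nth_equalityI)
qed (simp add: packed_def)

lemma Mqs_packed:
  assumes "\<forall>a\<in>set \<alpha>. 0 < a" "\<forall>b\<in>set \<beta>. 0 < b"
  shows "Mqs \<beta> (packed \<alpha>) = (if \<beta> = \<alpha> then 1 else 0)"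
proof -
  have "{is. length is = length \<beta> \<and> sorted_wrt (<) is \<and> place is \<beta> = packed \<alpha>}
      = (if \<beta> = \<alpha> then {[0..<length \<alpha>]} else {})"
    using place_eq_packed_iff[OF assms] by auto
  then show ?thesis by (simp add: Mqs_def place_def)
qed

lemma Fqs_packed:
  assumes "\<forall>a\<in>set \<alpha>. 0 < a" "\<forall>b\<in>set \<beta>. 0 < b"
  shows "Fqs \<beta> (packed \<alpha>) = (if \<alpha> \<in> Comp (sum_list \<beta>) \<and> refines \<alpha> \<beta> then 1 else 0)"
proof -
  have "Fqs \<beta> (packed \<alpha>)
      = (\<Sum>\<gamma> | \<gamma> \<in> Comp (sum_list \<beta>) \<and> refines \<gamma> \<beta>. if \<gamma> = \<alpha> then 1 else 0)"
    unfolding Fqs_def using assms(1) by (intro sum.cong) (auto simp: Mqs_packed Comp_iff)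
  then show ?thesis by (simp add: sum.delta finite_Comp)
qed

text \<open>Refinement is unitriangular with respect to the number of parts.\<close>

lemma Fqs_independent:
  assumes "finite C" and pos: "\<forall>\<beta>\<in>C. \<forall>b\<in>set \<beta>. 0 < b"
    and zero: "\<And>m. (\<Sum>\<beta>\<in>C. c \<beta> * Fqs \<beta> m) = 0"
    and "\<beta> \<in> C"
  shows "c \<beta> = 0"
  using \<open>\<beta> \<in> C\<close>
proof (induction "length \<beta>" arbitrary: \<beta> rule: less_induct)
  case less
  \<comment> \<open>The coefficient at the packed monomial of \<beta> sees only those \<gamma> that
    \<beta> refines. Any such \<gamma> other than \<beta> has fewer parts, so its coefficient
    vanishes by induction. The set C may mix degrees.\<close>
  have "c \<gamma> * Fqs \<gamma> (packed \<beta>) = (if \<gamma> = \<beta> then c \<beta> else 0)" if "\<gamma> \<in> C" for \<gamma>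
  proof (cases "refines \<beta> \<gamma> \<and> \<gamma> \<noteq> \<beta>")
    case True
    then have "length \<gamma> < length \<beta>"
      using refines_length[of \<beta> \<gamma>] pos that by (metis le_neq_implies_less)
    then show ?thesis using less that True by simp
  next
    case False
    then show ?thesis
      using pos that less.prems by (auto simp: Fqs_packed refines_refl Comp_iff)
  qed
  then have "(\<Sum>\<gamma>\<in>C. c \<gamma> * Fqs \<gamma> (packed \<beta>)) = c \<beta>"
    using less.prems \<open>finite C\<close> by (simp add: sum.delta cong: sum.cong)
  then show ?case using zero by simp
qed

text \<open>\<open>theta\<close> treats the constant term separately; this shows that it does not
  interfere in positive degree. A nonempty index list with positive exponents never gives the
  monomial 1.\<close>

lemma Fqs_at_0:
  assumes "sum_list \<alpha> > 0"
  shows "Fqs \<alpha> 0 = 0"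
proof -
  have "Mqs \<beta> 0 = 0" if "\<beta> \<in> Comp (sum_list \<alpha>)" for \<beta>
  proof -
    have "\<beta> \<noteq> []" and pos: "\<forall>b\<in>set \<beta>. 0 < b"
      using that assms by (auto simp: Comp_iff simp del: sum_list_eq_0_iff)
    then have "place is \<beta> \<noteq> 0" if "sorted_wrt (<) is" "length is = length \<beta>" for "is"
      using keys_place[of "is" \<beta>] that by (auto simp: strict_sorted_iff)
    then have "{is. length is = length \<beta> \<and> sorted_wrt (<) is \<and> place is \<beta> = 0} = {}" by auto
    then show ?thesis unfolding Mqs_def place_def by (simp only: card.empty of_nat_0)
  qed
  then show ?thesis by (simp add: Fqs_def)
qed

section \<open>Injectivity of gamma and the values of theta on the F\<close>

lemma gamma_superset:
  assumes "finite V" "Poly_Mapping.keys p \<subseteq> V"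
  shows "gamma p m = (\<Sum>u\<in>V. Poly_Mapping.lookup p u * Fqs (word_comp (letters u)) m)"
  unfolding gamma_def word_comp_def using assms
  by (intro sum.mono_neutral_left) (auto simp: in_keys_iff)

lemma gamma_add: "gamma (p + q) m = gamma p m + gamma q m"
  using Poly_Mapping.keys_add[of p q]
  by (simp add: gamma_superset[of "Poly_Mapping.keys p \<union> Poly_Mapping.keys q"] lookup_add
      distrib_right sum.distrib)

lemma gamma_diff: "gamma (p - q) m = gamma p m - gamma q m"
  using gamma_add[of "p - q" q m] by simp

lemma gamma_sum: "gamma (\<Sum>i\<in>I. p i) m = (\<Sum>i\<in>I. gamma (p i) m)"
  by (induction I rule: infinite_finite_induct) (simp_all add: gamma_add, simp_all add: gamma_def)

lemma gamma_single: "gamma (Poly_Mapping.single (Word u) c) m = c * Fqs (word_comp u) m"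
  by (subst gamma_superset[of "{Word u}"]) auto

text \<open>Distinct words have distinct compositions, so a polynomial in the kernel is a linear
  relation among the F.\<close>

lemma inj_gamma: "inj gamma"
proof (rule injI)
  fix p q assume "gamma p = gamma q"
  define d where "d = p - q"
  have "gamma d m = 0" for m
    using \<open>gamma p = gamma q\<close> by (simp add: d_def gamma_diff)
  have inj: "inj_on (\<lambda>u. word_comp (letters u)) (Poly_Mapping.keys d)"
    by (auto intro!: inj_onI dest!: word_comp_inject simp: abword.expand)
  let ?w = "\<lambda>u. word_comp (letters u)"
  have "Poly_Mapping.lookup d u = 0" if "u \<in> Poly_Mapping.keys d" for u
  proof -
    \<comment> \<open>A relation among the F is indexed by compositions, so the coefficients of d
      are transported along the inverse of the injective passage from words to compositions.\<close>
    have "(Poly_Mapping.lookup d \<circ> the_inv_into (Poly_Mapping.keys d) ?w) (?w u) = 0"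
    proof (rule Fqs_independent[where C = "?w ` Poly_Mapping.keys d"])
      fix m
      have "(\<Sum>\<beta>\<in>?w ` Poly_Mapping.keys d.
          (Poly_Mapping.lookup d \<circ> the_inv_into (Poly_Mapping.keys d) ?w) \<beta> * Fqs \<beta> m) = gamma d m"
        unfolding sum.reindex[OF inj] gamma_superset[OF finite_keys subset_refl]
        by (intro sum.cong refl) (simp add: the_inv_into_f_f[OF inj])
      then show "(\<Sum>\<beta>\<in>?w ` Poly_Mapping.keys d.
          (Poly_Mapping.lookup d \<circ> the_inv_into (Poly_Mapping.keys d) ?w) \<beta> * Fqs \<beta> m) = 0"
        using \<open>gamma d m = 0\<close> by simp
    qed (use that word_comp_in_Comp in \<open>auto simp: Comp_iff\<close>)
    then show ?thesis using that by (simp add: the_inv_into_f_f[OF inj])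
  qed
  then have "d = 0" by (metis in_keys_iff poly_mapping_eqI lookup_zero)
  then show "p = q" by (simp add: d_def)
qed

lemma theta_Fqs: "theta r (Fqs (word_comp u)) = gamma (const r * omega_word r u)"
proof -
  have "Fqs (word_comp u) 0 = 0"
    using word_comp_in_Comp[of u] by (intro Fqs_at_0) (simp add: Comp_iff)
  then have "(\<lambda>m. if m = 0 then 0 else Fqs (word_comp u) m) = gamma (word u)"
    by (auto simp: gamma_single)
  moreover have "omega r (word u) = omega_word r u"
    by (simp add: omega_def)
  ultimately show ?thesis
    using \<open>Fqs (word_comp u) 0 = 0\<close>
    by (auto simp: theta_def the_inv_f_f[OF inj_gamma])
qed

section \<open>The map omega as a sum over signs\<close>

definition sgn_at :: "bool list \<Rightarrow> nat \<Rightarrow> real" where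
  "sgn_at s i = (if s ! (i - 1) then 1 else -1)"

text \<open>The probability of a sign list without its denominator: each sign contributes r times
  1/r or r times 1 - 1/r. These are the coefficients that occur in
  \<open>omega_word\<close>.\<close>

definition weight :: "real \<Rightarrow> bool list \<Rightarrow> real" where
  "weight r s = (\<Prod>b\<leftarrow>s. if b then 1 else r - 1)"

lemma weight_simps [simp]:
  "weight r [] = 1" "weight r (b # s) = (if b then 1 else r - 1) * weight r s"
  by (simp_all add: weight_def)

text \<open>Multiplying by signs preserves or reverses each comparison of adjacent entries according to
  the sign of the larger one: the right entry at a letter a, the left entry at a letter b.\<close>

fun flip_word :: "letter list \<Rightarrow> bool list \<Rightarrow> letter list" where
  "flip_word (A # u) (b # c # s) = (if c then A else B) # flip_word u (c # s)"
| "flip_word (B # u) (b # s) = (if b then B else A) # flip_word u s"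
| "flip_word _ _ = []"

lemma finite_signs [simp]: "finite {s :: bool list. length s = n}"
  using finite_lists_length_eq[of "UNIV :: bool set" n] by simp

lemma sum_signs_Suc:
  fixes f :: "bool list \<Rightarrow> 'a :: comm_monoid_add"
  shows "(\<Sum>s | length s = Suc n. f s) = (\<Sum>b\<in>UNIV. \<Sum>s | length s = n. f (b # s))"
proof -
  have set: "{s :: bool list. length s = Suc n} = (\<lambda>(b, s). b # s) ` (UNIV \<times> {s. length s = n})"
    by (force simp: length_Suc_conv)
  have inj: "inj_on (\<lambda>(b, s). b # s) (UNIV \<times> {s :: bool list. length s = n})"
    by (auto intro: inj_onI)
  show ?thesis
    unfolding set sum.reindex[OF inj] by (simp add: sum.cartesian_product case_prod_unfold)
qed

text \<open>There is one sign more than letters, because n - 1 letters compare n entries.\<close>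

definition flip_sum :: "real \<Rightarrow> letter list \<Rightarrow> abpoly" where
  "flip_sum r u = (\<Sum>s | length s = Suc (length u).
     Poly_Mapping.single (Word (flip_word u s)) (weight r s))"

lemma single_times_single:
  "Poly_Mapping.single (Word u) c * Poly_Mapping.single (Word v) d
    = Poly_Mapping.single (Word (u @ v)) (c * d :: real)"
  by (simp add: mult_single plus_abword_def)

lemma const_times_single:
  "const c * Poly_Mapping.single w d = Poly_Mapping.single w (c * d)"
  by (simp add: mult_single)

text \<open>A leading b is ruled by the first sign, which no later letter uses, so the sum factors
  at once.\<close>

lemma flip_sum_B:
  "flip_sum r (B # u) = (word [B] + const (r - 1) * word [A]) * flip_sum r u"
  by (simp add: flip_sum_def sum_signs_Suc[of _ "Suc (length u)"] UNIV_bool sum_distrib_left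
      distrib_right single_times_single const_times_single sum.distrib add.commute)

text \<open>The first sign matters only if the first letter is b.\<close>

definition flip_sum_tail :: "real \<Rightarrow> letter list \<Rightarrow> abpoly" where
  "flip_sum_tail r u = (\<Sum>s | length s = length u.
     Poly_Mapping.single (Word (flip_word u (True # s))) (weight r s))"

lemma flip_word_first_sign:
  "u = [] \<or> hd u = A \<Longrightarrow> flip_word u (b # s) = flip_word u (c # s)"
  by (cases u; cases s) auto

text \<open>The first sign changes no letter here, so summing over it gives 1 + (r - 1) = r.\<close>

lemma flip_sum_tail:
  assumes "u = [] \<or> hd u = A"
  shows "flip_sum r u = const r * flip_sum_tail r u"
proof -
  have F: "flip_word u (False # s) = flip_word u (True # s)" for s
    by (rule flip_word_first_sign[OF assms])
  have "flip_sum r u = (\<Sum>s | length s = length u.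
      Poly_Mapping.single (Word (flip_word u (True # s))) ((r - 1) * weight r s)
      + Poly_Mapping.single (Word (flip_word u (True # s))) (weight r s))"
    by (simp add: flip_sum_def sum_signs_Suc UNIV_bool F sum.distrib)
  also have "\<dots> = const r * flip_sum_tail r u"
    unfolding flip_sum_tail_def sum_distrib_left
    by (intro sum.cong refl)
      (simp only: const_times_single left_diff_distrib mult_1 diff_add_cancel flip: single_add)
  finally show ?thesis .
qed

text \<open>The sign ruling the leading a is the first sign of u. It has no effect in u because u
  does not begin with b, so it splits off.\<close>

lemma flip_sum_tail_A:
  assumes "u = [] \<or> hd u = A"
  shows "flip_sum_tail r (A # u) = (word [A] + const (r - 1) * word [B]) * flip_sum_tail r u"
proof -
  have F: "flip_word u (False # s) = flip_word u (True # s)" for s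
    by (rule flip_word_first_sign[OF assms])
  show ?thesis
    by (simp add: flip_sum_tail_def sum_signs_Suc UNIV_bool F sum_distrib_left
      distrib_right single_times_single const_times_single sum.distrib add.commute)
qed

text \<open>The sign of the peak decides both letters together, hence no terms aa or bb. None of the
  signs left for u is used by the peak, so the full \<open>flip_sum\<close> of u remains.\<close>

lemma flip_sum_tail_AB:
  "flip_sum_tail r (A # B # u) = (word [A, B] + const (r - 1) * word [B, A]) * flip_sum r u"
  by (simp add: flip_sum_def flip_sum_tail_def sum_signs_Suc[of _ "Suc (length u)"] UNIV_bool
      sum_distrib_left distrib_right single_times_single const_times_single sum.distrib add.commute)

lemma const_commute_single:
  "Poly_Mapping.single w d * const (c :: real) = const c * Poly_Mapping.single w d"
  by (simp add: mult_single mult.commute)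

lemma const_commute_binomial:
  "(word u + const d * word v) * (const c * p) = const c * ((word u + const d * word v) * p)"
proof -
  have "(word u + const d * word v) * const c = const c * (word u + const d * word v)"
    by (simp add: const_times_single distrib_left distrib_right const_commute_single)
  then show ?thesis by (simp only: mult.assoc[symmetric])
qed

text \<open>The hypothesis is about r omega, not about the tail sum. Moving r through the binomial
  turns r times the tail sum into the sum for u, so that no division by r is needed.\<close>

lemma const_omega_word_A:
  assumes u: "u = [] \<or> hd u = A" and om: "const r * omega_word r u = flip_sum r u"
  shows "const r * omega_word r (A # u) = flip_sum r (A # u)"
proof -
  let ?X = "word [A] + const (r - 1) * word [B]"
  have "flip_sum r (A # u) = const r * (?X * flip_sum_tail r u)"
    by (subst flip_sum_tail) (simp_all add: flip_sum_tail_A[OF u])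
  also have "\<dots> = ?X * (const r * omega_word r u)"
    by (simp only: const_commute_binomial om flip_sum_tail[OF u])
  also have "\<dots> = const r * (?X * omega_word r u)"
    by (rule const_commute_binomial)
  also have "?X * omega_word r u = omega_word r (A # u)"
    using u by (cases u) auto
  finally show ?thesis ..
qed

lemma const_omega_word: "const r * omega_word r u = flip_sum r u"
proof (induction r u rule: omega_word.induct)
  case (1 r)
  show ?case using flip_sum_tail[of "[]" r]
    by (simp add: flip_sum_tail_def flip: zero_abword_def)
next
  case (2 r u)
  \<comment> \<open>The outer r is the free sign in front of the peak, the inner one comes with the
    induction hypothesis; the latter is the r that \<open>omega_word\<close> attaches to the block
    ab.\<close>
  have "flip_sum r (A # B # u)
      = const r * ((word [A, B] + const (r - 1) * word [B, A]) * (const r * omega_word r u))"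
    by (simp only: 2 flip_sum_tail[of "A # B # u"] flip_sum_tail_AB list.sel simp_thms)
  then show ?case
    by (simp only: omega_word.simps mult.assoc const_commute_binomial)
next
  case ("3_1" r)
  then show ?case by (intro const_omega_word_A[of "[]"]) simp_all
next
  case ("3_2" r v)
  then show ?case by (rule const_omega_word_A[rotated]) simp
next
  case (4 r u)
  show ?case
    by (simp only: omega_word.simps flip_sum_B const_commute_binomial flip: 4)
qed

lemma length_flip_word: "length s = Suc (length u) \<Longrightarrow> length (flip_word u s) = length u"
  by (induction u s rule: flip_word.induct) auto

lemma word_comp_flip_word:
  "length s = Suc (length u) \<Longrightarrow> word_comp (flip_word u s) \<in> Comp (Suc (length u))"
  using word_comp_in_Comp[of "flip_word u s"] length_flip_word[of s u] by simp

text \<open>Replaces the recursion by a rule for each position, to be compared with the descents of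
  a signed sequence.\<close>

lemma nth_flip_word:
  "length s = Suc (length u) \<Longrightarrow> k < length u \<Longrightarrow>
    flip_word u s ! k = (case u ! k of A \<Rightarrow> if s ! Suc k then A else B | B \<Rightarrow> if s ! k then B else A)"
proof (induction u s arbitrary: k rule: flip_word.induct)
  case (1 u b c s)
  then show ?case by (cases k) auto
next
  case (2 u b s)
  then show ?case by (cases k) auto
qed auto

section \<open>The matrix of theta in the F-basis\<close>

lemma theta_Fqs_expansion:
  "theta r (Fqs (word_comp u)) m
    = (\<Sum>\<beta>\<in>Comp (Suc (length u)).
        (\<Sum>s | length s = Suc (length u) \<and> word_comp (flip_word u s) = \<beta>.
        weight r s) * Fqs \<beta> m)"
proof -
  have "theta r (Fqs (word_comp u)) m
      = (\<Sum>s | length s = Suc (length u). weight r s * Fqs (word_comp (flip_word u s)) m)"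
    by (simp add: theta_Fqs const_omega_word flip_sum_def gamma_sum gamma_single)
  also have "\<dots> = (\<Sum>\<beta>\<in>Comp (Suc (length u)).
      \<Sum>s | s \<in> {s. length s = Suc (length u)} \<and> word_comp (flip_word u s) = \<beta>.
        weight r s * Fqs (word_comp (flip_word u s)) m)"
    by (intro sum.group[symmetric])
      (use word_comp_flip_word in \<open>auto simp: finite_Comp\<close>)
  also have "\<dots> = (\<Sum>\<beta>\<in>Comp (Suc (length u)).
      (\<Sum>s | length s = Suc (length u) \<and> word_comp (flip_word u s) = \<beta>.
        weight r s) * Fqs \<beta> m)"
    by (simp add: sum_distrib_right)
  finally show ?thesis .
qed

text \<open>Two candidates differ by a relation among the F, which is trivial; the support condition
  settles the values outside \<open>Comp\<close>.\<close>

lemma fcoeff_eqI: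
  assumes supp: "\<And>\<beta>. \<beta> \<notin> Comp (sum_list \<alpha>) \<Longrightarrow> c \<beta> = 0"
    and eq: "\<And>m. \<Phi> (Fqs \<alpha>) m = (\<Sum>\<beta>\<in>Comp (sum_list \<alpha>). c \<beta> * Fqs \<beta> m)"
  shows "fcoeff \<Phi> \<alpha> = c"
  unfolding fcoeff_def
proof (rule the_equality)
  fix d
  assume d: "(\<forall>\<beta>. \<beta> \<notin> Comp (sum_list \<alpha>) \<longrightarrow> d \<beta> = 0) \<and>
    \<Phi> (Fqs \<alpha>) = (\<lambda>m. \<Sum>\<beta>\<in>Comp (sum_list \<alpha>). d \<beta> * Fqs \<beta> m)"
  have "(\<lambda>\<beta>. d \<beta> - c \<beta>) \<beta> = 0" if "\<beta> \<in> Comp (sum_list \<alpha>)" for \<beta>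
  proof (rule Fqs_independent[OF finite_Comp _ _ that])
    fix m
    have "(\<Sum>\<beta>\<in>Comp (sum_list \<alpha>). d \<beta> * Fqs \<beta> m) = (\<Sum>\<beta>\<in>Comp (sum_list \<alpha>). c \<beta> * Fqs \<beta> m)"
      using d eq by metis
    then show "(\<Sum>\<beta>\<in>Comp (sum_list \<alpha>). (d \<beta> - c \<beta>) * Fqs \<beta> m) = 0"
      by (simp add: left_diff_distrib sum_subtractf)
  qed (auto simp: Comp_iff)
  with d supp show "d = c" by (metis eq_iff_diff_eq_0 ext)
qed (use supp eq in auto)

lemma fcoeff_theta:
  "fcoeff (theta r) (word_comp u) \<beta>
    = (\<Sum>s | length s = Suc (length u) \<and> word_comp (flip_word u s) = \<beta>. weight r s)"
proof -
  have sum: "sum_list (word_comp u) = Suc (length u)"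
    using word_comp_in_Comp[of u] by (simp add: Comp_iff)
  have "fcoeff (theta r) (word_comp u)
    = (\<lambda>\<beta>. \<Sum>s | length s = Suc (length u) \<and> word_comp (flip_word u s) = \<beta>. weight r s)"
  proof (rule fcoeff_eqI)
    fix \<beta> assume "\<beta> \<notin> Comp (sum_list (word_comp u))"
    then have none: "{s. length s = Suc (length u) \<and> word_comp (flip_word u s) = \<beta>} = {}"
      using word_comp_flip_word[of _ u] sum by auto
    show "(\<Sum>s | length s = Suc (length u) \<and> word_comp (flip_word u s) = \<beta>. weight r s) = 0"
      unfolding none by simp
  qed (simp only: sum theta_Fqs_expansion)
  then show ?thesis by simp
qed

text \<open>In degree 1 there is a single composition, so M and F agree, and F comes from the empty
  word, which r omega multiplies by r. A nonzero coefficient of M makes the eigenvalue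
  unique.\<close>

lemma lam_theta: "lam (theta r) = r"
proof -
  have "Comp 1 = {[1]}"
  proof (intro set_eqI iffI)
    fix \<alpha> assume "\<alpha> \<in> Comp 1"
    then show "\<alpha> \<in> {[1]}"
      by (cases \<alpha> rule: remdups_adj.cases) (auto simp: Comp_iff add_eq_if split: if_splits)
  qed (simp add: Comp_iff)
  then have "{\<beta>. \<beta> \<in> Comp 1 \<and> refines \<beta> [1]} = {[1]}"
    using refines_refl by auto
  then have M: "Mqs [1] = Fqs [1]" by (simp add: Fqs_def)
  have one: "[1] = word_comp []" by (simp add: word_comp_def bset_def co_empty)
  have theta: "theta r (Fqs [1]) = (\<lambda>m. r * Fqs [1] m)"
    unfolding one theta_Fqs by (simp add: zero_abword_def gamma_single fun_eq_iff)
  have packed: "Mqs [1] (packed [1]) = 1" by (subst Mqs_packed) auto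
  show ?thesis
    unfolding lam_def
  proof (rule the_equality)
    show "theta r (Mqs [1]) = (\<lambda>m. r * Mqs [1] m)" unfolding M by (rule theta)
    fix l assume "theta r (Mqs [1]) = (\<lambda>m. l * Mqs [1] m)"
    then have "r * Mqs [1] (packed [1]) = l * Mqs [1] (packed [1])"
      using theta unfolding M by metis
    then show "l = r" unfolding packed by simp
  qed
qed

section \<open>Descent words of signed sequences\<close>

definition descent_word :: "nat \<Rightarrow> (nat \<Rightarrow> real) \<Rightarrow> letter list" where
  "descent_word n w = map (\<lambda>i. if w i > w (i + 1) then B else A) [1..<n]"

lemma Dcomp_eq_word_comp:
  assumes "n \<ge> 1"
  shows "Dcomp n w = word_comp (descent_word n w)"
proof -
  have "{i. 1 \<le> i \<and> i < n \<and> w i > w (i + 1)} = bset (descent_word n w)"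
    by (auto simp: bset_def descent_word_def nth_Cons' split: if_splits)
  then show ?thesis using assms by (simp add: Dcomp_def word_comp_def descent_word_def)
qed

lemma flip_descent_word:
  assumes "length s = n" and "n \<ge> 1"
    and pos: "\<And>i. i \<in> {1..n} \<Longrightarrow> 0 < c i" and inj: "inj_on c {1..n}"
  shows "flip_word (descent_word n c) s = descent_word n (\<lambda>i. sgn_at s i * c i)"
proof -
  have len: "length s = Suc (length (descent_word n c))"
    using assms(1,2) by (simp add: descent_word_def)
  show ?thesis
  proof (rule nth_equalityI)
    show "length (flip_word (descent_word n c) s) = length (descent_word n (\<lambda>i. sgn_at s i * c i))"
      by (simp add: length_flip_word[OF len]) (simp add: descent_word_def)
    fix k assume "k < length (flip_word (descent_word n c) s)"
    then have k: "k < length (descent_word n c)" by (simp add: length_flip_word[OF len])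
    \<comment> \<open>The letter at list position k compares the entries k + 1 and k + 2, whose
      signs stand at list positions k and k + 1.\<close>
    then have "Suc k \<in> {1..n}" "Suc (Suc k) \<in> {1..n}" by (auto simp: descent_word_def)
    with pos inj have "0 < c (Suc k)" "0 < c (Suc (Suc k))" "c (Suc k) \<noteq> c (Suc (Suc k))"
      by (auto dest: inj_onD)
    with k show "flip_word (descent_word n c) s ! k = descent_word n (\<lambda>i. sgn_at s i * c i) ! k"
      by (auto simp: nth_flip_word[OF len k]) (auto simp: descent_word_def sgn_at_def)
  qed
qed

lemma fcoeff_theta_Dcomp:
  assumes "n \<ge> 1" and "\<And>i. i \<in> {1..n} \<Longrightarrow> 0 < c i" and "inj_on c {1..n}"
  shows "fcoeff (theta r) (Dcomp n c) \<beta>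
    = (\<Sum>s | length s = n \<and> Dcomp n (\<lambda>i. sgn_at s i * c i) = \<beta>. weight r s)"
proof -
  have len: "Suc (length (descent_word n c)) = n" using assms(1) by (simp add: descent_word_def)
  show ?thesis
    unfolding Dcomp_eq_word_comp[OF assms(1)] fcoeff_theta len
    using flip_descent_word[OF _ assms] by (intro sum.cong) auto
qed

section \<open>Independent random signs\<close>

text \<open>A common form for the events about \<open>st\<close> and \<open>Dcomp\<close>: they
  depend only on finitely many comparisons, hence are measurable and ignore values outside
  1..n.\<close>

definition order_invariant :: "nat \<Rightarrow> ((nat \<Rightarrow> real) \<Rightarrow> bool) \<Rightarrow> bool" where
  "order_invariant n Q \<longleftrightarrow>
    (\<forall>w w'. (\<forall>i\<in>{1..n}. \<forall>j\<in>{1..n}. w i < w j \<longleftrightarrow> w' i < w' j) \<longrightarrow> Q w = Q w')"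

lemma order_invariantI:
  "(\<And>w w'. \<forall>i\<in>{1..n}. \<forall>j\<in>{1..n}. w i < w j \<longleftrightarrow> w' i < w' j \<Longrightarrow> Q w = Q w') \<Longrightarrow> order_invariant n Q"
  by (auto simp: order_invariant_def)

lemma order_invariantD:
  "order_invariant n Q \<Longrightarrow> \<forall>i\<in>{1..n}. \<forall>j\<in>{1..n}. w i < w j \<longleftrightarrow> w' i < w' j \<Longrightarrow> Q w = Q w'"
  by (auto simp: order_invariant_def)

lemma order_invariant_st: "order_invariant n (\<lambda>w. st n w = \<tau>)"
proof (rule order_invariantI)
  fix w w' :: "nat \<Rightarrow> real"
  assume *: "\<forall>i\<in>{1..n}. \<forall>j\<in>{1..n}. w i < w j \<longleftrightarrow> w' i < w' j"
  have "st n w = st n w'"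
    unfolding st_def using * by (intro arg_cong[of _ _ The] ext) auto
  then show "st n w = \<tau> \<longleftrightarrow> st n w' = \<tau>" by simp
qed

lemma order_invariant_Dcomp: "order_invariant n (\<lambda>w. Dcomp n w = \<beta>)"
proof (rule order_invariantI)
  fix w w' :: "nat \<Rightarrow> real"
  assume "\<forall>i\<in>{1..n}. \<forall>j\<in>{1..n}. w i < w j \<longleftrightarrow> w' i < w' j"
  then have "{i. 1 \<le> i \<and> i < n \<and> w i > w (i + 1)} = {i. 1 \<le> i \<and> i < n \<and> w' i > w' (i + 1)}"
    by auto
  then show "Dcomp n w = \<beta> \<longleftrightarrow> Dcomp n w' = \<beta>" by (simp add: Dcomp_def)
qed

lemma order_invariant_compose:
  assumes "order_invariant n Q" "\<pi> permutes {1..n}"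
  shows "order_invariant n (\<lambda>w. Q (w \<circ> \<pi>))"
proof (rule order_invariantI, rule order_invariantD[OF assms(1)])
  fix w w' :: "nat \<Rightarrow> real"
  assume "\<forall>i\<in>{1..n}. \<forall>j\<in>{1..n}. w i < w j \<longleftrightarrow> w' i < w' j"
  then show "\<forall>i\<in>{1..n}. \<forall>j\<in>{1..n}. (w \<circ> \<pi>) i < (w \<circ> \<pi>) j \<longleftrightarrow> (w' \<circ> \<pi>) i < (w' \<circ> \<pi>) j"
    using permutes_in_image[OF assms(2)] unfolding o_def by blast
qed

text \<open>Q is a function of the set of pairs with a strict inequality. There are finitely many
  such sets, so the event is a finite union of measurable ones.\<close>

lemma order_invariant_measurable:
  assumes Q: "order_invariant n Q"
    and W: "\<And>i. i \<in> {1..n} \<Longrightarrow> W i \<in> borel_measurable M"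
  shows "{x \<in> space M. Q (\<lambda>i. W i x)} \<in> sets M"
proof -
  let ?I = "{1..n} \<times> {1..n}"
  define pat where "pat w = {p \<in> ?I. w (fst p) < w (snd p)}" for w :: "nat \<Rightarrow> real"
  have less_iff: "w i < w j \<longleftrightarrow> (i, j) \<in> pat w" if "i \<in> {1..n}" "j \<in> {1..n}" for w i j
    using that by (simp add: pat_def)
  have Q_pat: "Q w = Q w'" if "pat w = pat w'" for w w'
    by (rule order_invariantD[OF Q]) (intro ballI, simp only: less_iff that)
  have ex: "Q w \<longleftrightarrow> (\<exists>w'. Q w' \<and> pat w' = pat w)" for w
    using Q_pat by blast
  have pat_I: "pat w \<subseteq> ?I" for w by (auto simp: pat_def)
  have "{x \<in> space M. Q (\<lambda>i. W i x)}
      = (\<Union>R\<in>{R \<in> Pow ?I. \<exists>w. Q w \<and> pat w = R}. {x \<in> space M. pat (\<lambda>i. W i x) = R})"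
    by (subst ex) (use pat_I in blast)
  also have "\<dots> \<in> sets M"
  proof (intro sets.finite_UN)
    fix R assume "R \<in> {R \<in> Pow ?I. \<exists>w. Q w \<and> pat w = R}"
    then have "{x \<in> space M. pat (\<lambda>i. W i x) = R}
        = {x \<in> space M. \<forall>p\<in>?I. (W (fst p) x < W (snd p) x) = (p \<in> R)}"
      unfolding pat_def by blast
    also have "\<dots> \<in> sets M"
    proof (intro sets.sets_Collect_finite_All)
      fix p assume "p \<in> ?I"
      then have [measurable]: "W (fst p) \<in> borel_measurable M" "W (snd p) \<in> borel_measurable M"
        using W by auto
      show "{x \<in> space M. (W (fst p) x < W (snd p) x) = (p \<in> R)} \<in> sets M"
        by measurable
    qed simp
    finally show "{x \<in> space M. pat (\<lambda>i. W i x) = R} \<in> sets M" .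
  qed simp
  finally show ?thesis .
qed

context prob_space
begin

text \<open>Independence is a product formula over finite index sets, and a permutation relabels the
  factors.\<close>

lemma indep_vars_reindex_permutes:
  assumes indep: "indep_vars (\<lambda>_. N) X I" and "finite I" and \<pi>: "\<pi> permutes I"
  shows "indep_vars (\<lambda>_. N) (\<lambda>i. X (\<pi> i)) I"
proof -
  have ind: "indep_sets (\<lambda>i. {X i -` A \<inter> space M |A. A \<in> sets N}) I"
    and rv: "\<And>i. i \<in> I \<Longrightarrow> random_variable N (X i)"
    using indep by (auto simp: indep_vars_def2)
  have "indep_sets (\<lambda>i. {X (\<pi> i) -` A \<inter> space M |A. A \<in> sets N}) I"
  proof (rule indep_setsI)
    fix i assume "i \<in> I"
    then have "random_variable N (X (\<pi> i))" using rv permutes_in_image[OF \<pi>] by blast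
    then show "{X (\<pi> i) -` A \<inter> space M |A. A \<in> sets N} \<subseteq> events" by (auto intro: measurable_sets)
  next
    fix A J
    assume J: "J \<noteq> {}" "J \<subseteq> I" "finite J"
      and A: "\<forall>j\<in>J. A j \<in> {X (\<pi> j) -` A \<inter> space M |A. A \<in> sets N}"
    let ?B = "\<lambda>k. A (inv \<pi> k)"
    have inj: "inj_on \<pi> J" using permutes_inj[OF \<pi>] by (rule inj_on_subset) simp
    have inv: "inv \<pi> (\<pi> j) = j" for j using permutes_inverses(2)[OF \<pi>] .
    have "prob (\<Inter>k\<in>\<pi> ` J. ?B k) = (\<Prod>k\<in>\<pi> ` J. prob (?B k))"
      using J A permutes_in_image[OF \<pi>] by (intro indep_setsD[OF ind]) (auto simp: inv)
    then show "prob (\<Inter>j\<in>J. A j) = (\<Prod>j\<in>J. prob (A j))"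
      by (simp add: prod.reindex[OF inj] inv)
  qed
  then show ?thesis
    using rv permutes_in_image[OF \<pi>] by (auto simp: indep_vars_def2)
qed

end

text \<open>These hypotheses are stable under permuting the indices, so every consequence also holds
  for the rearranged signs.\<close>

locale random_signs = prob_space +
  fixes \<delta> :: "nat \<Rightarrow> 'a \<Rightarrow> real" and n :: nat and r :: real
  assumes indep: "indep_vars (\<lambda>_. borel) \<delta> {1..n}" and n: "n \<ge> 1" and r: "r > 1"
    and plus: "\<And>i. i \<in> {1..n} \<Longrightarrow> \<P>(x in M. \<delta> i x = 1) = 1 / r"
    and minus: "\<And>i. i \<in> {1..n} \<Longrightarrow> \<P>(x in M. \<delta> i x = -1) = 1 - 1 / r"
begin

lemma random_signs_reindex:
  assumes \<pi>: "\<pi> permutes {1..n}"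
  shows "random_signs M (\<lambda>i. \<delta> (\<pi> i)) n r"
  using indep_vars_reindex_permutes[OF indep _ \<pi>] permutes_in_image[OF \<pi>] n r plus minus
  by unfold_locales auto

text \<open>Since 1/r + (1 - 1/r) = 1, almost surely every variable is 1 or -1. Up to a null set the
  event is therefore a disjoint union of the events \<open>E s\<close>, whose probabilities are
  products by independence.\<close>

lemma prob_order_invariant:
  assumes Q: "order_invariant n Q"
  shows "\<P>(x in M. Q (\<lambda>i. \<delta> i x * c i))
    = (\<Sum>s | length s = n \<and> Q (\<lambda>i. sgn_at s i * c i). weight r s) / r ^ n"
proof -
  have rv [measurable]: "\<And>i. i \<in> {1..n} \<Longrightarrow> \<delta> i \<in> borel_measurable M"
    using indep by (auto simp: indep_vars_def2)
  define E where "E s = {x \<in> space M. \<forall>i\<in>{1..n}. \<delta> i x = sgn_at s i}" for s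
  have E_sets: "E s \<in> events" for s
    unfolding E_def by measurable
  have prob_E: "prob (E s) = weight r s / r ^ n" if "length s = n" for s
  proof -
    have "E s = (\<Inter>i\<in>{1..n}. \<delta> i -` {sgn_at s i} \<inter> space M)"
      using n by (auto simp: E_def)
    also have "prob \<dots> = (\<Prod>i\<in>{1..n}. prob (\<delta> i -` {sgn_at s i} \<inter> space M))"
      using n by (intro indep_varsD_finite[OF indep]) auto
    also have "\<dots> = (\<Prod>i\<in>{1..n}. (if s ! (i - 1) then 1 else r - 1) / r)"
    proof (rule prod.cong)
      fix i assume i: "i \<in> {1..n}"
      have "\<delta> i -` {sgn_at s i} \<inter> space M = {x \<in> space M. \<delta> i x = sgn_at s i}" by auto
      then show "prob (\<delta> i -` {sgn_at s i} \<inter> space M) = (if s ! (i - 1) then 1 else r - 1) / r"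
        using plus[OF i] minus[OF i] r by (simp add: sgn_at_def diff_divide_distrib)
    qed simp
    also have "\<dots> = (\<Prod>i\<in>{1..n}. if s ! (i - 1) then 1 else r - 1) / r ^ n"
      by (simp add: prod_dividef)
    also have "(\<Prod>i\<in>{1..n}. if s ! (i - 1) then 1 else r - 1) = weight r s"
    proof -
      have "weight r s = (\<Prod>i<n. if s ! i then 1 else r - 1)"
        by (simp add: weight_def prod.list_conv_set_nth that atLeast0LessThan)
      also have "\<dots> = (\<Prod>i\<in>{1..n}. if s ! (i - 1) then 1 else r - 1)"
        by (rule prod.reindex_bij_witness[of _ "\<lambda>i. i - 1" Suc]) auto
      finally show ?thesis ..
    qed
    finally show ?thesis .
  qed
  have disj: "disjoint_family_on E {s. length s = n \<and> P s}" for P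
  proof (unfold disjoint_family_on_def, intro ballI impI)
    fix s t assume st: "s \<in> {s. length s = n \<and> P s}" "t \<in> {s. length s = n \<and> P s}" "s \<noteq> t"
    then obtain k where "k < n" "s ! k \<noteq> t ! k" by (auto simp: list_eq_iff_nth_eq)
    then have "Suc k \<in> {1..n}" "sgn_at s (Suc k) \<noteq> sgn_at t (Suc k)" by (auto simp: sgn_at_def)
    then show "E s \<inter> E t = {}" unfolding E_def by auto
  qed
  have AE_sign: "AE x in M. \<delta> i x = 1 \<or> \<delta> i x = -1" if "i \<in> {1..n}" for i
  proof -
    note [measurable] = rv[OF that]
    have "\<P>(x in M. \<delta> i x = 1 \<or> \<delta> i x = -1) = \<P>(x in M. \<delta> i x = 1) + \<P>(x in M. \<delta> i x = -1)"
      by (subst finite_measure_Union[symmetric]) (auto intro!: arg_cong[of _ _ prob])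
    also have "\<dots> = 1" using plus[OF that] minus[OF that] by simp
    finally show ?thesis by (subst prob_Collect_eq_1[symmetric]) auto
  qed
  have "AE x in M. \<forall>i\<in>{1..n}. \<delta> i x = 1 \<or> \<delta> i x = -1"
    using AE_sign by (intro AE_finite_allI) auto
  then have "AE x in M. x \<in> {x \<in> space M. Q (\<lambda>i. \<delta> i x * c i)}
      \<longleftrightarrow> x \<in> (\<Union>s\<in>{s. length s = n \<and> Q (\<lambda>i. sgn_at s i * c i)}. E s)"
  proof (rule AE_mp[OF _ AE_I2[OF impI]])
    fix x assume x: "x \<in> space M" and pm: "\<forall>i\<in>{1..n}. \<delta> i x = 1 \<or> \<delta> i x = -1"
    \<comment> \<open>Membership in \<open>E s\<close> fixes the values on 1..n only; order
      invariance makes this enough.\<close>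
    have E_iff: "Q (\<lambda>i. \<delta> i x * c i) \<longleftrightarrow> Q (\<lambda>i. sgn_at s i * c i)" if "x \<in> E s" for s
      using that by (intro order_invariantD[OF Q]) (auto simp: E_def)
    define s where "s = map (\<lambda>i. \<delta> (Suc i) x = 1) [0..<n]"
    have "\<delta> i x = sgn_at s i" if "i \<in> {1..n}" for i
    proof -
      have "s ! (i - 1) \<longleftrightarrow> \<delta> i x = 1" using that by (cases i) (auto simp: s_def simp del: upt_Suc)
      then show ?thesis using pm that unfolding sgn_at_def by metis
    qed
    then have "x \<in> E s" using x by (simp add: E_def)
    moreover have "length s = n" by (simp add: s_def)
    ultimately show "x \<in> {x \<in> space M. Q (\<lambda>i. \<delta> i x * c i)}
      \<longleftrightarrow> x \<in> (\<Union>s\<in>{s. length s = n \<and> Q (\<lambda>i. sgn_at s i * c i)}. E s)"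
      using x E_iff by auto
  qed
  then have "\<P>(x in M. Q (\<lambda>i. \<delta> i x * c i))
      = prob (\<Union>s\<in>{s. length s = n \<and> Q (\<lambda>i. sgn_at s i * c i)}. E s)"
    by (rule finite_measure_eq_AE)
      (auto intro!: order_invariant_measurable[OF Q] E_sets sets.finite_UN)
  also have "\<dots> = (\<Sum>s | length s = n \<and> Q (\<lambda>i. sgn_at s i * c i). prob (E s))"
    by (intro finite_measure_finite_Union disj) (auto intro: E_sets)
  also have "\<dots> = (\<Sum>s | length s = n \<and> Q (\<lambda>i. sgn_at s i * c i). weight r s / r ^ n)"
    by (intro sum.cong) (auto simp: prob_E)
  finally show ?thesis by (simp add: sum_divide_distrib)
qed

end

section \<open>Standardization by ranks\<close>

lemma card_le_permutes:
  assumes \<tau>: "\<tau> permutes {1..n}" and i: "i \<in> {1..n}"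
  shows "card {j \<in> {1..n}. \<tau> j \<le> \<tau> i} = \<tau> i"
proof -
  have "\<tau> ` {j \<in> {1..n}. \<tau> j \<le> \<tau> i} = {1..\<tau> i}"
  proof (intro equalityI subsetI)
    fix k assume k: "k \<in> {1..\<tau> i}"
    then have "k \<in> {1..n}" using permutes_in_image[OF \<tau>, of i] i by auto
    then have "inv \<tau> k \<in> {1..n}" "\<tau> (inv \<tau> k) = k"
      using permutes_in_image[OF permutes_inv[OF \<tau>]] permutes_inverses(1)[OF \<tau>] by blast+
    with k show "k \<in> \<tau> ` {j \<in> {1..n}. \<tau> j \<le> \<tau> i}"
      by (metis (mono_tags, lifting) atLeastAtMost_iff image_eqI mem_Collect_eq)
  qed (use permutes_in_image[OF \<tau>] in auto)
  moreover have "inj_on \<tau> {j \<in> {1..n}. \<tau> j \<le> \<tau> i}"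
    using permutes_inj[OF \<tau>] by (rule inj_on_subset) simp
  ultimately show ?thesis by (metis card_image card_atLeastAtMost diff_Suc_1)
qed

text \<open>The value of a permutation at i is the rank of i, which the comparisons
  determine.\<close>

lemma permutes_order_unique:
  fixes \<tau> \<rho> :: "nat \<Rightarrow> nat"
  assumes \<tau>: "\<tau> permutes {1..n}" and \<rho>: "\<rho> permutes {1..n}"
    and ord: "\<forall>i\<in>{1..n}. \<forall>j\<in>{1..n}. \<tau> i < \<tau> j \<longleftrightarrow> \<rho> i < \<rho> j"
  shows "\<tau> = \<rho>"
proof
  fix i
  show "\<tau> i = \<rho> i"
  proof (cases "i \<in> {1..n}")
    case True
    have "\<tau> j \<le> \<tau> i \<longleftrightarrow> \<rho> j \<le> \<rho> i" if "j \<in> {1..n}" for j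
      using bspec[OF bspec[OF ord True] that] by (metis not_less)
    then have "{j \<in> {1..n}. \<tau> j \<le> \<tau> i} = {j \<in> {1..n}. \<rho> j \<le> \<rho> i}" by blast
    then show ?thesis using card_le_permutes[OF \<tau> True] card_le_permutes[OF \<rho> True] by simp
  next
    case False
    then show ?thesis using permutes_not_in[OF \<tau>] permutes_not_in[OF \<rho>] by simp
  qed
qed

lemma rank_permutes:
  fixes w :: "nat \<Rightarrow> real"
  assumes inj: "inj_on w {1..n}"
  shows "\<exists>\<tau>. \<tau> permutes {1..n} \<and> (\<forall>i\<in>{1..n}. \<forall>j\<in>{1..n}. w i < w j \<longleftrightarrow> \<tau> i < \<tau> j)"
proof -
  \<comment> \<open>The rank of i, counted with \<le> so that ranks start at 1, and the identity
    outside 1..n as \<open>permutes\<close> requires.\<close>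
  define \<tau> where "\<tau> i = (if i \<in> {1..n} then card {j \<in> {1..n}. w j \<le> w i} else i)" for i
  have less: "\<tau> i < \<tau> j" if "i \<in> {1..n}" "j \<in> {1..n}" "w i < w j" for i j
  proof -
    have "{k \<in> {1..n}. w k \<le> w i} \<subseteq> {k \<in> {1..n}. w k \<le> w j}"
      using that by auto
    moreover have "j \<in> {k \<in> {1..n}. w k \<le> w j}" "j \<notin> {k \<in> {1..n}. w k \<le> w i}"
      using that by auto
    ultimately have "{k \<in> {1..n}. w k \<le> w i} \<subset> {k \<in> {1..n}. w k \<le> w j}" by blast
    then show ?thesis using that unfolding \<tau>_def by (simp add: psubset_card_mono)
  qed
  have iff: "w i < w j \<longleftrightarrow> \<tau> i < \<tau> j" if "i \<in> {1..n}" "j \<in> {1..n}" for i j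
    using less[OF that] less[OF that(2,1)] inj_onD[OF inj _ that]
    by (metis less_asym' less_irrefl linorder_neqE)
  have "\<tau> permutes {1..n}"
  proof (rule bij_imp_permutes)
    have "inj_on \<tau> {1..n}"
      using iff inj by (metis (no_types, lifting) inj_onD inj_onI less_irrefl linorder_neqE)
    moreover have "\<tau> ` {1..n} \<subseteq> {1..n}"
    proof
      fix k assume "k \<in> \<tau> ` {1..n}"
      then obtain i where i: "i \<in> {1..n}" "k = card {j \<in> {1..n}. w j \<le> w i}"
        by (auto simp: \<tau>_def)
      have "card {i} \<le> k" unfolding i(2) using i(1) by (intro card_mono) auto
      moreover have "k \<le> card {1..n}" unfolding i(2) by (intro card_mono) auto
      ultimately show "k \<in> {1..n}" by simp
    qed
    ultimately show "bij_betw \<tau> {1..n} {1..n}"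
      by (simp add: bij_betw_def endo_inj_surj)
  qed (auto simp: \<tau>_def)
  with iff show ?thesis by blast
qed

text \<open>Ranks give existence and the preceding uniqueness gives the rest, so the description in
  \<open>st\<close> may be replaced by its property.\<close>

lemma st_eq_iff:
  assumes "inj_on w {1..n}" and \<tau>: "\<tau> permutes {1..n}"
  shows "st n w = \<tau> \<longleftrightarrow> (\<forall>i\<in>{1..n}. \<forall>j\<in>{1..n}. w i < w j \<longleftrightarrow> \<tau> i < \<tau> j)"
proof -
  obtain \<rho> where \<rho>: "\<rho> permutes {1..n}" "\<forall>i\<in>{1..n}. \<forall>j\<in>{1..n}. w i < w j \<longleftrightarrow> \<rho> i < \<rho> j"
    using rank_permutes[OF assms(1)] by blast
  have "st n w = \<rho>"
    unfolding st_def by (rule the_equality) (use \<rho> permutes_order_unique in \<open>blast+\<close>)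
  with \<rho> \<tau> show ?thesis by (metis permutes_order_unique)
qed

lemma st_permutes:
  assumes "inj_on w {1..n}"
  shows "st n w permutes {1..n}"
  using rank_permutes[OF assms] st_eq_iff[OF assms] by metis

lemma Dcomp_eq_singleton_iff:
  assumes "n \<ge> 1"
  shows "Dcomp n w = [n] \<longleftrightarrow> (\<forall>i. 1 \<le> i \<and> i < n \<longrightarrow> w i \<le> w (i + 1))"
proof -
  define S where "S = {i. 1 \<le> i \<and> i < n \<and> w i > w (i + 1)}"
  have sub: "S \<subseteq> {1..<n}" by (auto simp: S_def)
  have "Dcomp n w = [n] \<longleftrightarrow> co n S = co n {}" by (simp only: Dcomp_def co_empty S_def)
  also have "\<dots> \<longleftrightarrow> S = {}" using co_inject[OF sub empty_subsetI] by blast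
  also have "\<dots> \<longleftrightarrow> (\<forall>i. 1 \<le> i \<and> i < n \<longrightarrow> w i \<le> w (i + 1))"
    by (auto simp: S_def not_less)
  finally show ?thesis .
qed

lemma Dcomp_eq_singleton_iff_increasing:
  assumes "n \<ge> 1" and inj: "inj_on w {1..n}"
  shows "Dcomp n w = [n] \<longleftrightarrow> (\<forall>i\<in>{1..n}. \<forall>j\<in>{1..n}. w i < w j \<longleftrightarrow> i < j)"
proof
  assume "Dcomp n w = [n]"
  then have step: "w i \<le> w (Suc i)" if "1 \<le> i" "i < n" for i
    using that by (simp add: Dcomp_eq_singleton_iff[OF assms(1)])
  have mono: "w i \<le> w j" if "i \<le> j" "1 \<le> i" "j \<le> n" for i j
    using that
  proof (induction j rule: dec_induct)
    case (step k)
    then show ?case using \<open>\<And>i. 1 \<le> i \<Longrightarrow> i < n \<Longrightarrow> w i \<le> w (Suc i)\<close>[of k] by simp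
  qed simp
  show "\<forall>i\<in>{1..n}. \<forall>j\<in>{1..n}. w i < w j \<longleftrightarrow> i < j"
  proof (intro ballI)
    fix i j assume "i \<in> {1..n}" "j \<in> {1..n}"
    then show "w i < w j \<longleftrightarrow> i < j"
      using mono[of i j] mono[of j i] inj_onD[OF inj, of i j] by (cases i j rule: linorder_cases) force+
  qed
next
  assume "\<forall>i\<in>{1..n}. \<forall>j\<in>{1..n}. w i < w j \<longleftrightarrow> i < j"
  then show "Dcomp n w = [n]"
    by (auto simp: Dcomp_eq_singleton_iff[OF assms(1)] intro!: less_imp_le)
qed

lemma st_eq_iff_Dcomp:
  assumes "n \<ge> 1" and inj: "inj_on w {1..n}" and \<tau>: "\<tau> permutes {1..n}"
  shows "st n w = \<tau> \<longleftrightarrow> Dcomp n (w \<circ> inv \<tau>) = [n]"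
proof -
  have inv: "inv \<tau> (\<tau> i) = i" "\<tau> (inv \<tau> i) = i" for i
    using permutes_inverses[OF \<tau>] by simp_all
  have inj': "inj_on (w \<circ> inv \<tau>) {1..n}"
    using inj permutes_image[OF permutes_inv[OF \<tau>]] permutes_inj[OF permutes_inv[OF \<tau>]]
    by (intro comp_inj_on) (auto intro: inj_on_subset)
  have "st n w = \<tau> \<longleftrightarrow> (\<forall>i\<in>{1..n}. \<forall>j\<in>{1..n}. w i < w j \<longleftrightarrow> \<tau> i < \<tau> j)"
    by (rule st_eq_iff[OF inj \<tau>])
  \<comment> \<open>The image of 1..n under the inverse is 1..n again; writing it so substitutes the
    indices and turns the pattern of \<tau> into that of the identity.\<close>
  also have "\<dots> \<longleftrightarrow> (\<forall>i\<in>inv \<tau> ` {1..n}. \<forall>j\<in>inv \<tau> ` {1..n}. w i < w j \<longleftrightarrow> \<tau> i < \<tau> j)"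
    by (simp only: permutes_image[OF permutes_inv[OF \<tau>]])
  also have "\<dots> \<longleftrightarrow> Dcomp n (w \<circ> inv \<tau>) = [n]"
    by (simp add: Dcomp_eq_singleton_iff_increasing[OF assms(1) inj'] inv)
  finally show ?thesis .
qed

text \<open>Absolute values recover the entries of \<sigma>, so signs create no ties.\<close>

lemma inj_on_signed_permutation:
  assumes "\<sigma> permutes {1..n}"
  shows "inj_on (\<lambda>i. sgn_at s i * real (\<sigma> i)) {1..n}"
proof (rule inj_onI)
  fix i j assume "sgn_at s i * real (\<sigma> i) = sgn_at s j * real (\<sigma> j)"
  then have "\<bar>sgn_at s i * real (\<sigma> i)\<bar> = \<bar>sgn_at s j * real (\<sigma> j)\<bar>" by simp
  then have "\<sigma> i = \<sigma> j" by (simp add: abs_mult sgn_at_def split: if_splits)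
  then show "i = j" using permutes_inj[OF assms] by (simp add: injD)
qed

section \<open>The chain on permutations\<close>

context random_signs
begin

lemma prob_st_eq:
  assumes \<sigma>: "\<sigma> permutes {1..n}" and \<tau>: "\<tau> permutes {1..n}"
  shows "\<P>(x in M. st n (\<lambda>i. \<delta> i x * real (\<sigma> i)) = \<tau>)
    = \<P>(x in M. Dcomp n (\<lambda>i. \<delta> i x * real ((\<sigma> \<circ> inv \<tau>) i)) = [n])"
proof -
  note inv\<tau> = permutes_inv[OF \<tau>]
  interpret re: random_signs M "\<lambda>i. \<delta> (inv \<tau> i)" n r
    by (rule random_signs_reindex[OF inv\<tau>])
  have "\<P>(x in M. st n (\<lambda>i. \<delta> i x * real (\<sigma> i)) = \<tau>)
      = (\<Sum>s | length s = n \<and> st n (\<lambda>i. sgn_at s i * real (\<sigma> i)) = \<tau>. weight r s) / r ^ n"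
    by (rule prob_order_invariant[OF order_invariant_st])
  \<comment> \<open>The equivalence is applied inside the sum because it needs entries without ties,
    which genuine signs guarantee while the random variables do so only almost surely.\<close>
  also have "\<dots> = (\<Sum>s | length s = n \<and> Dcomp n ((\<lambda>i. sgn_at s i * real (\<sigma> i)) \<circ> inv \<tau>) = [n].
      weight r s) / r ^ n"
    by (simp only: st_eq_iff_Dcomp[OF n inj_on_signed_permutation[OF \<sigma>] \<tau>])
  also have "\<dots> = \<P>(x in M. Dcomp n ((\<lambda>i. \<delta> i x * real (\<sigma> i)) \<circ> inv \<tau>) = [n])"
    by (rule prob_order_invariant[OF order_invariant_compose[OF order_invariant_Dcomp inv\<tau>], symmetric])
  also have "\<dots> = \<P>(x in M. Dcomp n (\<lambda>i. \<delta> (inv \<tau> i) x * real ((\<sigma> \<circ> inv \<tau>) i)) = [n])"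
    by (simp add: o_def)
  also have "\<dots> = \<P>(x in M. Dcomp n (\<lambda>i. \<delta> i x * real ((\<sigma> \<circ> inv \<tau>) i)) = [n])"
    \<comment> \<open>Both probabilities equal the same sum over sign lists, in which the random
      family no longer appears.\<close>
    by (simp only: prob_order_invariant[OF order_invariant_Dcomp] re.prob_order_invariant[OF order_invariant_Dcomp])
  finally show ?thesis .
qed

lemma fcoeff_theta_eq_prob:
  assumes \<pi>: "\<pi> permutes {1..n}"
  shows "fcoeff (theta r) (Dperm n \<pi>) \<beta>
    = r ^ n * \<P>(x in M. Dcomp n (\<lambda>i. \<delta> i x * real (\<pi> i)) = \<beta>)"
proof -
  have "inj_on (\<lambda>i. real (\<pi> i)) {1..n}"
    by (simp add: inj_on_def inj_eq[OF permutes_inj[OF \<pi>]])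
  moreover have "0 < real (\<pi> i)" if "i \<in> {1..n}" for i
    using permutes_in_image[OF \<pi>, of i] that by simp
  ultimately have "fcoeff (theta r) (Dperm n \<pi>) \<beta>
      = (\<Sum>s | length s = n \<and> Dcomp n (\<lambda>i. sgn_at s i * real (\<pi> i)) = \<beta>. weight r s)"
    unfolding Dperm_def by (intro fcoeff_theta_Dcomp[OF n])
  then show ?thesis
    using r by (simp add: prob_order_invariant[OF order_invariant_Dcomp])
qed

text \<open>Each sign list is counted for exactly one \<rho>, the inverse of the standardization of
  the signed identity, so the sum is the total weight of all sign lists.\<close>

lemma sum_fcoeff_theta:
  "(\<Sum>\<rho> | \<rho> permutes {1..n}. fcoeff (theta r) (Dperm n \<rho>) [n]) = r ^ n"
proof -
  let ?w = "\<lambda>s i. sgn_at s i * real (id i)"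
  have id: "id permutes {1..n}" by (rule permutes_id)
  have "fcoeff (theta r) (Dperm n \<rho>) [n]
      = (\<Sum>s | s \<in> {s. length s = n} \<and> inv (st n (?w s)) = \<rho>. weight r s)"
    if \<rho>: "\<rho> permutes {1..n}" for \<rho>
  proof -
    have iff: "st n (?w s) = inv \<rho> \<longleftrightarrow> inv (st n (?w s)) = \<rho>" for s
      using permutes_inv_inv[OF \<rho>] permutes_inv_inv[OF st_permutes[OF inj_on_signed_permutation[OF id]]]
      by metis
    have "fcoeff (theta r) (Dperm n \<rho>) [n]
        = r ^ n * \<P>(x in M. st n (\<lambda>i. \<delta> i x * real (id i)) = inv \<rho>)"
      using prob_st_eq[OF id permutes_inv[OF \<rho>]] permutes_inv_inv[OF \<rho>]
      by (simp only: fcoeff_theta_eq_prob[OF \<rho>] id_comp)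
    also have "\<dots> = (\<Sum>s | length s = n \<and> st n (?w s) = inv \<rho>. weight r s)"
      using r prob_order_invariant[OF order_invariant_st, where c = "\<lambda>i. real (id i)"] by simp
    also have "\<dots> = (\<Sum>s | s \<in> {s. length s = n} \<and> inv (st n (?w s)) = \<rho>. weight r s)"
      by (simp only: iff mem_Collect_eq)
    finally show ?thesis .
  qed
  then have "(\<Sum>\<rho> | \<rho> permutes {1..n}. fcoeff (theta r) (Dperm n \<rho>) [n])
      = (\<Sum>\<rho> | \<rho> permutes {1..n}. \<Sum>s | s \<in> {s. length s = n} \<and> inv (st n (?w s)) = \<rho>. weight r s)"
    by (intro sum.cong) auto
  also have "\<dots> = (\<Sum>s | length s = n. weight r s)"
    using st_permutes[OF inj_on_signed_permutation[OF id]]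
    by (intro sum.group) (auto intro: permutes_inv finite_permutations)
  also have "\<dots> = r ^ n"
    \<comment> \<open>The sure event has probability 1, which evaluates the total weight.\<close>
    using prob_order_invariant[of "\<lambda>_. True"] prob_space r by (simp add: order_invariant_def)
  finally show ?thesis .
qed

end

theorem theorem8p4:
  fixes r :: real and n :: nat and M :: "'w measure" and \<delta> :: "nat \<Rightarrow> 'w \<Rightarrow> real"
    and \<sigma> \<tau> :: "nat \<Rightarrow> nat" and \<beta> :: "nat list"
  assumes "r > 1" and "n \<ge> 1"
    and "prob_space M"
    and "prob_space.indep_vars M (\<lambda>_. borel) \<delta> {1..n}"
    and "\<And>i. i \<in> {1..n} \<Longrightarrow> \<P>(x in M. \<delta> i x = 1) = 1 / r"
    and "\<And>i. i \<in> {1..n} \<Longrightarrow> \<P>(x in M. \<delta> i x = -1) = 1 - 1 / r"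
    and "\<sigma> permutes {1..n}" and "\<tau> permutes {1..n}" and "\<beta> \<in> Comp n"
  shows "K (theta r) n \<sigma> \<tau> = \<P>(x in M. st n (\<lambda>i. \<delta> i x * real (\<sigma> i)) = \<tau>) \<and>
         Kbar (theta r) n (Dperm n \<sigma>) \<beta> = \<P>(x in M. Dcomp n (\<lambda>i. \<delta> i x * real (\<sigma> i)) = \<beta>)"
proof -
  interpret prob_space M by fact
  interpret random_signs M \<delta> n r
    using assms by unfold_locales auto
  have \<pi>: "\<sigma> \<circ> inv \<tau> permutes {1..n}"
    using assms by (intro permutes_compose permutes_inv)
  \<comment> \<open>The inverse in the definition of \<open>K\<close> produces the very permutation
    whose signed version must have no descents.\<close>
  have "inv (\<tau> \<circ> inv \<sigma>) = \<sigma> \<circ> inv \<tau>"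
    using o_inv_distrib[OF permutes_bij[OF assms(8)] permutes_bij[OF permutes_inv[OF assms(7)]]]
    by (simp add: permutes_inv_inv[OF assms(7)])
  then have "K (theta r) n \<sigma> \<tau> = \<P>(x in M. st n (\<lambda>i. \<delta> i x * real (\<sigma> i)) = \<tau>)"
    using r by (simp only: K_def Prob_def sum_fcoeff_theta fcoeff_theta_eq_prob[OF \<pi>]
        prob_st_eq[OF assms(7,8)]) simp
  moreover have "Kbar (theta r) n (Dperm n \<sigma>) \<beta> = \<P>(x in M. Dcomp n (\<lambda>i. \<delta> i x * real (\<sigma> i)) = \<beta>)"
    using r by (simp add: Kbar_def lam_theta fcoeff_theta_eq_prob[OF assms(7)])
  ultimately show ?thesis ..
qed

end
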